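(* Let $R$ be a weakly $2$-primal ring and let $\alpha$ be an endomorphism of $R$ such that $R$ is $\alpha$-compatible. Then the following two statements are equivalent: (1) $R[x;\alpha]$ is a $W\Delta U$ ring. (2) $R$ is a $W\Delta U$ ring.
   Context: Rings are associative with identity (and homomorphisms preserve it), not necessarily commutative. $R[x;\alpha]$ is the skew polynomial ring: polynomials in $x$ with coefficients in $R$ and multiplication determined by $xr=\alpha(r)x$ for all $r\in R$. $R$ is $\alpha$-compatible if for all $a,b\in R$: $ab=0\iff a\alpha(b)=0$. $R$ is weakly $2$-primal if $\mathrm{Nil}(R)=L(R)$, where $\mathrm{Nil}(R)$ is the set of nilpotent elements and $L(R)$ is the Levitzki radical (the largest locally nilpotent ideal) of $R$. $U(S)$ is the group of units of a ring $S$. $\Delta(S)=\{r\in S : r+u\in U(S)\text{ for all }u\in U(S)\}$; equivalently $\Delta(S)=J(T)$, where $T$ is the subring of $S$ generated by $U(S)$ and $J$ denotes the Jacobson radical. $S$ is $W\Delta U$ if $U(S)=\pm 1+\Delta(S)$, i.e. every unit of $S$ has the form $1+d$ or $-1+d$ with $d\in\Delta(S)$. *)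

theory Defs
  imports "HOL-Algebra.UnivPoly"
begin

definition nilpotents :: "('a, 'm) ring_scheme \<Rightarrow> 'a set" where
  "nilpotents R = {a \<in> carrier R. \<exists>n::nat. n > 0 \<and> a [^]\<^bsub>R\<^esub> n = \<zero>\<^bsub>R\<^esub>}"

text \<open>
  A subset \<open>S\<close> is locally nilpotent if every finite subset of \<open>S\<close> generates a nilpotent
  (non-unital) subring, that is, for every finite \<open>F \<subseteq> S\<close> there is an \<open>N\<close> such that all products
  of \<open>N\<close> factors from \<open>F\<close> vanish.
\<close>

definition locally_nilpotent :: "('a, 'm) ring_scheme \<Rightarrow> 'a set \<Rightarrow> bool" where
  "locally_nilpotent R S \<longleftrightarrow>
     (\<forall>F. finite F \<and> F \<subseteq> S \<longrightarrow>
        (\<exists>N. \<forall>xs. set xs \<subseteq> F \<and> length xs = N \<longrightarrow> foldr (\<otimes>\<^bsub>R\<^esub>) xs \<one>\<^bsub>R\<^esub> = \<zero>\<^bsub>R\<^esub>))"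

definition levitzki_radical :: "('a, 'm) ring_scheme \<Rightarrow> 'a set" where
  "levitzki_radical R = (GREATEST I. ideal I R \<and> locally_nilpotent R I)"

definition weakly_2_primal :: "('a, 'm) ring_scheme \<Rightarrow> bool" where
  "weakly_2_primal R \<longleftrightarrow> nilpotents R = levitzki_radical R"

definition compatible :: "('a, 'm) ring_scheme \<Rightarrow> ('a \<Rightarrow> 'a) \<Rightarrow> bool" where
  "compatible R \<alpha> \<longleftrightarrow>
     (\<forall>a \<in> carrier R. \<forall>b \<in> carrier R. a \<otimes>\<^bsub>R\<^esub> b = \<zero>\<^bsub>R\<^esub> \<longleftrightarrow> a \<otimes>\<^bsub>R\<^esub> \<alpha> b = \<zero>\<^bsub>R\<^esub>)"

text \<open>
  Elements of the skew polynomial ring are the finitely supported coefficient functions of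
  \<^const>\<open>up\<close>, with coefficients written to the left of the powers of \<open>x\<close>. The rule
  \<open>x r = \<alpha>(r) x\<close> gives \<open>(a x\<^sup>i) (b x\<^sup>j) = a \<alpha>\<^sup>i(b) x\<^sup>i\<^sup>+\<^sup>j\<close>, whence the product below.
\<close>

definition skew_poly :: "('a, 'm) ring_scheme \<Rightarrow> ('a \<Rightarrow> 'a) \<Rightarrow> (nat \<Rightarrow> 'a) ring" where
  "skew_poly R \<alpha> =
     \<lparr>carrier = up R,
      mult = (\<lambda>f g n. \<Oplus>\<^bsub>R\<^esub>i \<in> {..n}. f i \<otimes>\<^bsub>R\<^esub> (\<alpha> ^^ i) (g (n - i))),
      one = (\<lambda>n. if n = 0 then \<one>\<^bsub>R\<^esub> else \<zero>\<^bsub>R\<^esub>),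
      zero = (\<lambda>n. \<zero>\<^bsub>R\<^esub>),
      add = (\<lambda>f g n. f n \<oplus>\<^bsub>R\<^esub> g n)\<rparr>"

definition Delta :: "('a, 'm) ring_scheme \<Rightarrow> 'a set" where
  "Delta S = {r \<in> carrier S. \<forall>u \<in> Units S. r \<oplus>\<^bsub>S\<^esub> u \<in> Units S}"

definition WDeltaU :: "('a, 'm) ring_scheme \<Rightarrow> bool" where
  "WDeltaU S \<longleftrightarrow>
     Units S = {\<one>\<^bsub>S\<^esub> \<oplus>\<^bsub>S\<^esub> d | d. d \<in> Delta S} \<union> {\<ominus>\<^bsub>S\<^esub> \<one>\<^bsub>S\<^esub> \<oplus>\<^bsub>S\<^esub> d | d. d \<in> Delta S}"

end

theory Submission imports Defs begin

text \<open>
  Let \<open>N\<close> be the set of nilpotent elements of \<open>R\<close>, a locally nilpotent ideal by hypothesis. Since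
  \<open>R / N\<close> is reduced and inherits compatibility, the units of \<open>R[x;\<alpha>]\<close> are constant modulo \<open>N\<close>;
  local nilpotency makes every polynomial over \<open>N\<close> nilpotent. Hence both the units and \<open>\<Delta>\<close> of
  \<open>R[x;\<alpha>]\<close> are those of \<open>R\<close> plus \<open>N[x;\<alpha>] x\<close>, and the two conditions agree.
\<close>

section \<open>The Levitzki radical\<close>

text \<open>\<open>levitzki_radical\<close> is a \<open>GREATEST\<close>, which gives no information
  until a greatest locally nilpotent ideal is known to exist; the crux there is that sums of locally
  nilpotent ideals stay locally nilpotent. Local nilpotency, and not just nilpotency of single
  elements, is what makes polynomials over \<open>nilpotents R\<close> nilpotent: a coefficient of a
  power of \<open>f\<close> mixes words in different coefficients of \<open>f\<close>, so one length
  must kill all words over a finite set. Compatibility gives no equation between \<open>a\<close>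
  and \<open>\<alpha> a\<close>; it only compares when products vanish. Every use of it is therefore
  phrased as vanishing or nilpotency of a product. The quotient by \<open>nilpotents R\<close> is
  never formed: congruences are statements of membership in the ideal.\<close>

context ring
begin

lemma foldr_mult_closed:
  "set xs \<subseteq> carrier R \<Longrightarrow> foldr (\<otimes>) xs \<one> \<in> carrier R"
  by (induction xs) auto

lemma foldr_mult_append:
  "set xs \<subseteq> carrier R \<Longrightarrow> set ys \<subseteq> carrier R \<Longrightarrow>
   foldr (\<otimes>) (xs @ ys) \<one> = foldr (\<otimes>) xs \<one> \<otimes> foldr (\<otimes>) ys \<one>"
  by (induction xs) (auto simp: foldr_mult_closed m_assoc simp del: foldr_append)

text \<open>Regrouping for the sum of two ideals: words of length \<open>n\<close> will have
  products in the second ideal, and these products then serve as the letters of a word of length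
  \<open>m\<close>.\<close>

lemma foldr_mult_blocks:
  assumes "length xs = n * m" "set xs \<subseteq> F" "F \<subseteq> carrier R"
  shows "\<exists>ws. length ws = m \<and>
    set ws \<subseteq> (\<lambda>w. foldr (\<otimes>) w \<one>) ` {w. set w \<subseteq> F \<and> length w = n} \<and>
    foldr (\<otimes>) ws \<one> = foldr (\<otimes>) xs \<one>"
  using assms(1,2)
proof (induction m arbitrary: xs)
  case 0
  then show ?case by simp
next
  case (Suc m)
  have "length (drop n xs) = n * m" "set (drop n xs) \<subseteq> F"
    using Suc.prems set_drop_subset[of n xs] by auto
  from Suc.IH[OF this] obtain ws where ws: "length ws = m"
    "set ws \<subseteq> (\<lambda>w. foldr (\<otimes>) w \<one>) ` {w. set w \<subseteq> F \<and> length w = n}"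
    "foldr (\<otimes>) ws \<one> = foldr (\<otimes>) (drop n xs) \<one>" by blast
  have tk: "set (take n xs) \<subseteq> F" "length (take n xs) = n"
    using Suc.prems set_take_subset[of n xs] by auto
  have "foldr (\<otimes>) xs \<one> = foldr (\<otimes>) (take n xs) \<one> \<otimes> foldr (\<otimes>) (drop n xs) \<one>"
    using foldr_mult_append[of "take n xs" "drop n xs"] tk assms(3)
      \<open>set (drop n xs) \<subseteq> F\<close> by (metis append_take_drop_id subset_trans)
  with ws tk show ?case
    by (intro exI[of _ "foldr (\<otimes>) (take n xs) \<one> # ws"]) auto
qed

text \<open>Congruence modulo \<open>J\<close> is multiplicative; the difference of the two products
  telescopes, exchanging one factor at a time.\<close>

lemma foldr_mult_diff_in_ideal:
  assumes "ideal J R" "set xs \<subseteq> carrier R" "\<And>x. x \<in> set xs \<Longrightarrow> p x \<in> carrier R"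
    and "\<And>x. x \<in> set xs \<Longrightarrow> x \<ominus> p x \<in> J"
  shows "foldr (\<otimes>) xs \<one> \<ominus> foldr (\<otimes>) (map p xs) \<one> \<in> J"
proof -
  interpret J: ideal J R by fact
  show ?thesis
    using assms(2-)
  proof (induction xs)
    case Nil
    then show ?case by (simp add: a_minus_def r_neg)
  next
    case (Cons x xs)
    let ?u = "foldr (\<otimes>) xs \<one>" and ?v = "foldr (\<otimes>) (map p xs) \<one>"
    have IH: "?u \<ominus> ?v \<in> J" using Cons by simp
    have c: "x \<in> carrier R" "p x \<in> carrier R" "?u \<in> carrier R" "?v \<in> carrier R"
      using Cons.prems by (auto intro!: foldr_mult_closed)
    have "x \<otimes> ?u \<ominus> p x \<otimes> ?v = x \<otimes> (?u \<ominus> ?v) \<oplus> (x \<ominus> p x) \<otimes> ?v"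
    proof -
      have "x \<otimes> (?u \<ominus> ?v) \<oplus> (x \<ominus> p x) \<otimes> ?v
        = x \<otimes> ?u \<oplus> (\<ominus> (x \<otimes> ?v) \<oplus> x \<otimes> ?v) \<oplus> \<ominus> (p x \<otimes> ?v)"
        using c by (simp add: a_minus_def r_distr l_distr r_minus l_minus a_assoc)
      then show ?thesis using c by (simp add: l_neg a_minus_def)
    qed
    moreover have "x \<otimes> (?u \<ominus> ?v) \<in> J" "(x \<ominus> p x) \<otimes> ?v \<in> J"
      using IH Cons.prems c by (auto intro: J.I_l_closed J.I_r_closed)
    ultimately show ?case by simp
  qed
qed

text \<open>Modulo \<open>J\<close>, a product of elements \<open>a + b\<close> of \<open>I + J\<close> agrees with the product of the
  \<open>a\<close>, so every sufficiently long one falls into \<open>J\<close>.\<close>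
lemma locally_nilpotent_set_add:
  assumes I: "ideal I R" "locally_nilpotent R I" and J: "ideal J R" "locally_nilpotent R J"
  shows "locally_nilpotent R (I <+>\<^bsub>R\<^esub> J)"
  unfolding locally_nilpotent_def
proof (intro allI impI, elim conjE)
  interpret I: ideal I R by fact
  interpret J: ideal J R by fact
  fix F assume F: "finite F" "F \<subseteq> I <+>\<^bsub>R\<^esub> J"
  have Fc: "F \<subseteq> carrier R"
    using F(2) I.a_subset J.a_subset by (auto simp: set_add_def' subset_iff)
  have "\<exists>a\<in>I. x \<ominus> a \<in> J" if "x \<in> F" for x
  proof -
    have "x \<in> I <+>\<^bsub>R\<^esub> J" using that F(2) by blast
    then obtain a b where ab: "a \<in> I" "b \<in> J" "x = a \<oplus> b"
      unfolding set_add_def' by blast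
    have "a \<oplus> b \<ominus> a = b \<oplus> (a \<oplus> \<ominus> a)"
      using I.Icarr[OF ab(1)] J.Icarr[OF ab(2)] by (simp add: a_minus_def a_ac)
    then have "x \<ominus> a = b"
      using ab(3) I.Icarr[OF ab(1)] J.Icarr[OF ab(2)] by (simp add: r_neg)
    then show ?thesis using ab by blast
  qed
  then obtain p where p: "\<And>x. x \<in> F \<Longrightarrow> p x \<in> I" "\<And>x. x \<in> F \<Longrightarrow> x \<ominus> p x \<in> J"
    by metis
  have "finite (p ` F)" "p ` F \<subseteq> I" using F(1) p by auto
  then obtain n where n: "\<And>xs. set xs \<subseteq> p ` F \<Longrightarrow> length xs = n \<Longrightarrow> foldr (\<otimes>) xs \<one> = \<zero>"
    using I(2) unfolding locally_nilpotent_def by meson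
  \<comment> \<open>Local nilpotency of \<open>J\<close> speaks only of finite sets. Fixing the
    block length \<open>n\<close> leaves finitely many words over \<open>F\<close>, hence finitely
    many block products.\<close>
  define W where "W = (\<lambda>w. foldr (\<otimes>) w \<one>) ` {w. set w \<subseteq> F \<and> length w = n}"
  have "finite W" unfolding W_def using F(1) by (intro finite_imageI finite_lists_length_eq)
  moreover have "W \<subseteq> J"
  proof
    fix y assume "y \<in> W"
    then obtain w where w: "set w \<subseteq> F" "length w = n" "y = foldr (\<otimes>) w \<one>"
      by (auto simp: W_def)
    have "y \<ominus> foldr (\<otimes>) (map p w) \<one> \<in> J"
      unfolding w(3) using w(1) Fc p I.Icarr by (intro foldr_mult_diff_in_ideal J(1)) auto
    moreover have "foldr (\<otimes>) (map p w) \<one> = \<zero>" using w by (intro n) auto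
    moreover have "y \<in> carrier R" using w Fc by (auto intro!: foldr_mult_closed)
    ultimately show "y \<in> J" by (simp add: a_minus_def)
  qed
  ultimately obtain m where
    m: "\<And>xs. set xs \<subseteq> W \<Longrightarrow> length xs = m \<Longrightarrow> foldr (\<otimes>) xs \<one> = \<zero>"
    using J(2) unfolding locally_nilpotent_def by meson
  have "foldr (\<otimes>) xs \<one> = \<zero>" if xs: "set xs \<subseteq> F" "length xs = n * m" for xs
  proof -
    obtain ws where "length ws = m" "set ws \<subseteq> W" "foldr (\<otimes>) ws \<one> = foldr (\<otimes>) xs \<one>"
      using foldr_mult_blocks[OF xs(2,1) Fc, folded W_def] by blast
    with m show ?thesis by simp
  qed
  then show "\<exists>N. \<forall>xs. set xs \<subseteq> F \<and> length xs = N \<longrightarrow> foldr (\<otimes>) xs \<one> = \<zero>" by blast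
qed

lemma locally_nilpotent_zero: "locally_nilpotent R {\<zero>}"
proof -
  have "foldr (\<otimes>) xs \<one> = \<zero>" if "set xs \<subseteq> {\<zero>}" "length xs = Suc 0" for xs
    using that by (cases xs) auto
  then show ?thesis unfolding locally_nilpotent_def by (meson subset_trans)
qed

text \<open>The family of locally nilpotent ideals is directed, because it is closed under sums.
  Being an ideal and being locally nilpotent both test only finitely many elements at a time, so
  this carries them over to the union.\<close>

lemma finite_subset_locally_nilpotent_ideal:
  assumes "finite F" "F \<subseteq> \<Union>{I. ideal I R \<and> locally_nilpotent R I}"
  shows "\<exists>I. ideal I R \<and> locally_nilpotent R I \<and> F \<subseteq> I"
  using assms
proof (induction F rule: finite_induct)
  case empty
  then show ?case using zeroideal locally_nilpotent_zero by blast
next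
  case (insert x F)
  then obtain I J where IJ: "ideal I R" "locally_nilpotent R I" "F \<subseteq> I"
    "ideal J R" "locally_nilpotent R J" "x \<in> J" by auto
  interpret I: ideal I R by fact
  interpret J: ideal J R by fact
  have "\<zero> \<oplus> x \<in> I <+>\<^bsub>R\<^esub> J"
    using IJ(6) I.zero_closed unfolding set_add_def' by blast
  then have "x \<in> I <+>\<^bsub>R\<^esub> J"
    using J.Icarr[OF IJ(6)] by simp
  moreover have "I \<subseteq> I <+>\<^bsub>R\<^esub> J"
  proof
    fix y assume y: "y \<in> I"
    then have "y \<oplus> \<zero> \<in> I <+>\<^bsub>R\<^esub> J"
      using J.zero_closed unfolding set_add_def' by blast
    then show "y \<in> I <+>\<^bsub>R\<^esub> J"
      using I.Icarr[OF y] by simp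
  qed
  ultimately show ?case
    using IJ add_ideals locally_nilpotent_set_add by (metis insert_subset subset_trans)
qed

text \<open>The union of all locally nilpotent ideals is itself one, hence the greatest element that
  \<open>GREATEST\<close> asks for.\<close>

lemma
  shows ideal_levitzki_radical: "ideal (levitzki_radical R) R"
    and locally_nilpotent_levitzki_radical: "locally_nilpotent R (levitzki_radical R)"
proof -
  define L where "L = \<Union>{I. ideal I R \<and> locally_nilpotent R I}"
  have fin: "\<exists>I. ideal I R \<and> locally_nilpotent R I \<and> F \<subseteq> I \<and> I \<subseteq> L"
    if "finite F" "F \<subseteq> L" for F
    using finite_subset_locally_nilpotent_ideal[of F] that unfolding L_def by blast
  have sub: "L \<subseteq> carrier R"
    unfolding L_def using ideal.Icarr by fastforce
  have id: "ideal L R"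
  proof (rule idealI)
    show "ring R" by (rule ring_axioms)
    show "subgroup L (add_monoid R)"
    proof (rule add.subgroupI)
      show "L \<subseteq> carrier R" by (rule sub)
      obtain I where "ideal I R" "I \<subseteq> L" using fin[of "{}"] by auto
      then show "L \<noteq> {}"
        using additive_subgroup.zero_closed[OF ideal.axioms(1)] by blast
    next
      fix a assume "a \<in> L"
      then obtain I where I: "ideal I R" "a \<in> I" "I \<subseteq> L" using fin[of "{a}"] by auto
      show "\<ominus> a \<in> L"
        using additive_subgroup.a_inv_closed[OF ideal.axioms(1)[OF I(1)] I(2)] I(3) by (rule subsetD[rotated])
    next
      fix a b assume "a \<in> L" "b \<in> L"
      then obtain I where I: "ideal I R" "a \<in> I" "b \<in> I" "I \<subseteq> L"
        using fin[of "{a, b}"] by auto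
      show "a \<oplus> b \<in> L"
        using additive_subgroup.a_closed[OF ideal.axioms(1)[OF I(1)] I(2,3)] I(4)
        by (rule subsetD[rotated])
    qed
  next
    fix a x assume x: "a \<in> L" "x \<in> carrier R"
    then obtain I where I: "ideal I R" "a \<in> I" "I \<subseteq> L" using fin[of "{a}"] by auto
    show "x \<otimes> a \<in> L" "a \<otimes> x \<in> L"
      using ideal.I_l_closed[OF I(1,2) x(2)] ideal.I_r_closed[OF I(1,2) x(2)] I(3) by auto
  qed
  have ln: "locally_nilpotent R L"
    unfolding locally_nilpotent_def
  proof (intro allI impI, elim conjE)
    fix F assume F: "finite F" "F \<subseteq> L"
    then obtain I where "locally_nilpotent R I" "F \<subseteq> I" using fin by meson
    with F(1) show "\<exists>N. \<forall>xs. set xs \<subseteq> F \<and> length xs = N \<longrightarrow> foldr (\<otimes>) xs \<one> = \<zero>"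
      unfolding locally_nilpotent_def by blast
  qed
  have "levitzki_radical R = L"
    unfolding levitzki_radical_def
    by (rule Greatest_equality) (use id ln L_def in auto)
  with id ln show "ideal (levitzki_radical R) R" "locally_nilpotent R (levitzki_radical R)"
    by auto
qed

section \<open>Geometric series and a rearrangement of double sums\<close>

text \<open>With \<open>b = \<ominus> a\<close>, the partial geometric sums \<open>s\<close> satisfy
  \<open>(\<one> \<ominus> b) \<otimes> s = \<one> \<ominus> b [^] k\<close>, also on the other
  side; once the power vanishes, \<open>s\<close> is the inverse.\<close>

lemma Units_one_plus_nilpotent:
  assumes a: "a \<in> nilpotents R"
  shows "\<one> \<oplus> a \<in> Units R"
proof -
  obtain n where n: "(\<ominus> a) [^] (n::nat) = \<zero>" and ac: "a \<in> carrier R"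
  proof -
    obtain n :: nat where n: "a [^] n = \<zero>" and ac: "a \<in> carrier R"
      using a by (auto simp: nilpotents_def)
    have "(\<ominus> a) [^] k = a [^] k \<or> (\<ominus> a) [^] k = \<ominus> (a [^] k)" for k :: nat
      using ac by (induction k) (auto simp: l_minus r_minus)
    with n ac show ?thesis by (metis minus_zero that)
  qed
  define b where "b = \<ominus> a"
  have bc: "b \<in> carrier R" and b: "\<one> \<oplus> a = \<one> \<ominus> b"
    using ac by (auto simp: b_def a_minus_def)
  have "\<exists>s\<in>carrier R. (\<one> \<ominus> b) \<otimes> s = \<one> \<ominus> b [^] k \<and> s \<otimes> (\<one> \<ominus> b) = \<one> \<ominus> b [^] k" for k :: nat
  proof (induction k)
    case 0
    then show ?case using bc by (intro bexI[of _ \<zero>]) (auto simp: a_minus_def r_neg)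
  next
    case (Suc k)
    then obtain s where s: "s \<in> carrier R" "(\<one> \<ominus> b) \<otimes> s = \<one> \<ominus> b [^] k"
      "s \<otimes> (\<one> \<ominus> b) = \<one> \<ominus> b [^] k" by auto
    have p: "b [^] k \<in> carrier R" "b \<otimes> b [^] k = b [^] k \<otimes> b" "b [^] k \<otimes> b \<in> carrier R"
      using bc by (auto simp: nat_pow_comm[of b 1 k, simplified])
    have t: "\<one> \<ominus> b [^] k \<oplus> (b [^] k \<ominus> b [^] k \<otimes> b) = \<one> \<ominus> b [^] k \<otimes> b"
    proof -
      have "\<one> \<ominus> b [^] k \<oplus> (b [^] k \<ominus> b [^] k \<otimes> b)
        = \<one> \<oplus> (\<ominus> (b [^] k) \<oplus> b [^] k) \<oplus> \<ominus> (b [^] k \<otimes> b)"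
        using p by (simp add: a_minus_def a_assoc del: nat_pow_closed)
      then show ?thesis using p by (simp add: l_neg a_minus_def)
    qed
    have "(\<one> \<ominus> b) \<otimes> b [^] k = b [^] k \<ominus> b [^] k \<otimes> b" "b [^] k \<otimes> (\<one> \<ominus> b) = b [^] k \<ominus> b [^] k \<otimes> b"
      using p bc by (simp_all add: a_minus_def l_distr r_distr l_minus r_minus)
    then have "(\<one> \<ominus> b) \<otimes> (s \<oplus> b [^] k) = \<one> \<ominus> b [^] Suc k \<and>
      (s \<oplus> b [^] k) \<otimes> (\<one> \<ominus> b) = \<one> \<ominus> b [^] Suc k"
      using s p bc t by (simp add: l_distr r_distr)
    then show ?case using s p by blast
  qed
  from this[of n] obtain s where "s \<in> carrier R" "(\<one> \<ominus> b) \<otimes> s = \<one>" "s \<otimes> (\<one> \<ominus> b) = \<one>"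
    using n by (auto simp: b_def a_minus_def)
  then show ?thesis unfolding b Units_def using bc by auto
qed

text \<open>Both sides run over the triangle \<open>i + j \<le> n\<close>, by antidiagonals and by
  rows. Passing to \<open>Suc n\<close> adds one antidiagonal, that is, one entry at the end of each
  row and a new row of length one.\<close>

lemma finsum_diagonal:
  assumes "\<And>i j. F i j \<in> carrier R"
  shows "(\<Oplus>k\<in>{..n::nat}. \<Oplus>i\<in>{..k}. F i (k - i)) = (\<Oplus>i\<in>{..n}. \<Oplus>j\<in>{..n - i}. F i j)"
proof (induction n)
  case 0
  then show ?case using assms by simp
next
  case (Suc n)
  have "(\<Oplus>i\<in>{..n}. \<Oplus>j\<in>{..Suc n - i}. F i j)
    = (\<Oplus>i\<in>{..n}. (\<Oplus>j\<in>{..n - i}. F i j) \<oplus> F i (Suc n - i))"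
    using assms by (intro finsum_cong) (auto simp: Suc_diff_le a_comm simp_implies_def)
  also have "\<dots> = (\<Oplus>i\<in>{..n}. \<Oplus>j\<in>{..n - i}. F i j) \<oplus> (\<Oplus>i\<in>{..n}. F i (Suc n - i))"
    using assms by (intro finsum_addf) auto
  finally show ?case
    using Suc assms by (simp add: a_ac)
qed

end

section \<open>The skew polynomial ring\<close>

locale ring_endomorphism = ring R for R (structure) +
  fixes \<alpha> :: "'a \<Rightarrow> 'a"
  assumes hom: "\<alpha> \<in> ring_hom R R"
begin

lemma funpow_hom: "\<alpha> ^^ i \<in> ring_hom R R"
proof (induction i)
  case 0
  then show ?case by (auto intro: ring_hom_memI)
next
  case (Suc i)
  then show ?case using ring_hom_trans[OF Suc hom] by (simp only: funpow.simps)
qed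

sublocale funpow: ring_hom_ring R R "\<alpha> ^^ i" for i
  by (rule ring_hom_ringI2[OF ring_axioms ring_axioms funpow_hom])

abbreviation S where "S \<equiv> skew_poly R \<alpha>"

lemma skew_poly_simps [simp]:
  "carrier S = up R"
  "f \<otimes>\<^bsub>S\<^esub> g = (\<lambda>n. \<Oplus>i\<in>{..n}. f i \<otimes> (\<alpha> ^^ i) (g (n - i)))"
  "\<one>\<^bsub>S\<^esub> = (\<lambda>n. if n = 0 then \<one> else \<zero>)"
  "\<zero>\<^bsub>S\<^esub> = (\<lambda>n. \<zero>)"
  "f \<oplus>\<^bsub>S\<^esub> g = (\<lambda>n. f n \<oplus> g n)"
  by (simp_all add: skew_poly_def)

lemma coeff_closed: "f \<in> up R \<Longrightarrow> f n \<in> carrier R"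
  by auto

lemma funpow_closed: "x \<in> carrier R \<Longrightarrow> (\<alpha> ^^ i) x \<in> carrier R"
  by (rule funpow.hom_closed)

lemma skew_mult_closed:
  assumes "f \<in> up R" "g \<in> up R"
  shows "(\<lambda>n. \<Oplus>i\<in>{..n}. f i \<otimes> (\<alpha> ^^ i) (g (n - i))) \<in> up R"
proof
  show "(\<Oplus>i\<in>{..n}. f i \<otimes> (\<alpha> ^^ i) (g (n - i))) \<in> carrier R" for n
    using assms by (intro finsum_closed) (auto intro: funpow_closed coeff_closed)
  obtain n m where b: "bound \<zero> n f" "bound \<zero> m g" using assms bound_upD by metis
  have "(\<Oplus>i\<in>{..k}. f i \<otimes> (\<alpha> ^^ i) (g (k - i))) = \<zero>" if "n + m < k" for k
  proof -
    have "f i \<otimes> (\<alpha> ^^ i) (g (k - i)) = \<zero>" for i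
    proof (cases "n < i")
      case True
      then show ?thesis using b assms by (simp add: bound.bound coeff_closed)
    next
      case False
      then have "g (k - i) = \<zero>" using b that by (intro bound.bound[of _ m]) auto
      then show ?thesis using assms by (simp add: coeff_closed)
    qed
    then show ?thesis by (simp add: finsum_zero)
  qed
  then show "\<exists>n. bound \<zero> n (\<lambda>n. \<Oplus>i\<in>{..n}. f i \<otimes> (\<alpha> ^^ i) (g (n - i)))" by blast
qed

lemma skew_mult_assoc:
  assumes "f \<in> up R" "g \<in> up R" "h \<in> up R"
  shows "(f \<otimes>\<^bsub>S\<^esub> g) \<otimes>\<^bsub>S\<^esub> h = f \<otimes>\<^bsub>S\<^esub> (g \<otimes>\<^bsub>S\<^esub> h)"
proof
  fix n
  note c = assms[THEN coeff_closed]
  \<comment> \<open>\<open>F i j\<close> is the contribution to the coefficient of degree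
    \<open>n\<close> of the terms of degrees \<open>i\<close>, \<open>j\<close> and
    \<open>n - (i + j)\<close> of the three factors. Both bracketings sum it over
    \<open>i + j \<le> n\<close>, where the subtraction is not truncated.\<close>
  define F where "F i j = f i \<otimes> (\<alpha> ^^ i) (g j) \<otimes> (\<alpha> ^^ (i + j)) (h (n - (i + j)))" for i j
  have F: "F i j \<in> carrier R" for i j unfolding F_def using c by simp
  have "((f \<otimes>\<^bsub>S\<^esub> g) \<otimes>\<^bsub>S\<^esub> h) n = (\<Oplus>k\<in>{..n}. \<Oplus>i\<in>{..k}. F i (k - i))"
  proof -
    have "(\<Oplus>i\<in>{..k}. f i \<otimes> (\<alpha> ^^ i) (g (k - i))) \<otimes> (\<alpha> ^^ k) (h (n - k))
      = (\<Oplus>i\<in>{..k}. F i (k - i))" for k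
    proof -
      have "(\<Oplus>i\<in>{..k}. f i \<otimes> (\<alpha> ^^ i) (g (k - i))) \<otimes> (\<alpha> ^^ k) (h (n - k))
        = (\<Oplus>i\<in>{..k}. f i \<otimes> (\<alpha> ^^ i) (g (k - i)) \<otimes> (\<alpha> ^^ k) (h (n - k)))"
        using c by (intro finsum_ldistr) auto
      also have "\<dots> = (\<Oplus>i\<in>{..k}. F i (k - i))"
        using c by (intro finsum_cong) (auto simp: F_def simp_implies_def)
      finally show ?thesis .
    qed
    then show ?thesis by simp
  qed
  also have "\<dots> = (\<Oplus>i\<in>{..n}. \<Oplus>j\<in>{..n - i}. F i j)"
    by (rule finsum_diagonal[OF F])
  also have "\<dots> = (f \<otimes>\<^bsub>S\<^esub> (g \<otimes>\<^bsub>S\<^esub> h)) n"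
  proof -
    have "(\<Oplus>j\<in>{..n - i}. F i j)
      = f i \<otimes> (\<alpha> ^^ i) (\<Oplus>j\<in>{..n - i}. g j \<otimes> (\<alpha> ^^ j) (h (n - i - j)))" for i
    proof -
      have "(\<alpha> ^^ i) (\<Oplus>j\<in>{..n - i}. g j \<otimes> (\<alpha> ^^ j) (h (n - i - j)))
        = (\<Oplus>j\<in>{..n - i}. ((\<alpha> ^^ i) \<circ> (\<lambda>j. g j \<otimes> (\<alpha> ^^ j) (h (n - i - j)))) j)"
        using c by (intro funpow.hom_finsum) auto
      also have "\<dots> = (\<Oplus>j\<in>{..n - i}. (\<alpha> ^^ i) (g j) \<otimes> (\<alpha> ^^ (i + j)) (h (n - (i + j))))"
        using c by (intro finsum_cong) (auto simp: funpow_add simp_implies_def)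
      also have "f i \<otimes> \<dots> = (\<Oplus>j\<in>{..n - i}. f i \<otimes> ((\<alpha> ^^ i) (g j) \<otimes> (\<alpha> ^^ (i + j)) (h (n - (i + j)))))"
        using c by (intro finsum_rdistr) auto
      also have "\<dots> = (\<Oplus>j\<in>{..n - i}. F i j)"
        using c by (intro finsum_cong) (auto simp: F_def m_assoc simp_implies_def)
      finally show ?thesis by simp
    qed
    then show ?thesis by simp
  qed
  finally show "((f \<otimes>\<^bsub>S\<^esub> g) \<otimes>\<^bsub>S\<^esub> h) n = (f \<otimes>\<^bsub>S\<^esub> (g \<otimes>\<^bsub>S\<^esub> h)) n" .
qed

lemma finsum_eq_single:
  assumes "i \<in> A" "finite A" "\<And>j. j \<in> A \<Longrightarrow> j \<noteq> i \<Longrightarrow> h j = \<zero>" "h i \<in> carrier R"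
  shows "(\<Oplus>j\<in>A. h j) = h i"
proof -
  have "(\<Oplus>j\<in>A. h j) = (\<Oplus>j\<in>A. if i = j then h j else \<zero>)"
    using assms by (intro finsum_cong') auto
  also have "\<dots> = (\<Oplus>j\<in>A. if i = j then (\<lambda>_. h i) j else \<zero>)"
    by (rule arg_cong[where f = "\<lambda>g. finsum R g A"]) auto
  also have "\<dots> = h i" using assms by (subst add.finprod_singleton) auto
  finally show ?thesis .
qed

definition const :: "'a \<Rightarrow> nat \<Rightarrow> 'a"
  where "const a = (\<lambda>n. if n = 0 then a else \<zero>)"

lemma const_closed: "a \<in> carrier R \<Longrightarrow> const a \<in> up R"
  unfolding const_def up_def by force

text \<open>A constant on the left has no power of \<open>x\<close> to move past the coefficients of
  \<open>f\<close>, so no \<open>\<alpha>\<close> appears.\<close>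

lemma const_mult:
  assumes "a \<in> carrier R" "f \<in> up R"
  shows "const a \<otimes>\<^bsub>S\<^esub> f = (\<lambda>n. a \<otimes> f n)"
proof
  fix n
  show "(const a \<otimes>\<^bsub>S\<^esub> f) n = a \<otimes> f n"
    unfolding skew_poly_simps
    using assms by (subst finsum_eq_single[of 0]) (auto simp: const_def coeff_closed)
qed

lemma mult_one_S:
  assumes "f \<in> up R"
  shows "f \<otimes>\<^bsub>S\<^esub> \<one>\<^bsub>S\<^esub> = f"
proof
  fix n
  show "(f \<otimes>\<^bsub>S\<^esub> \<one>\<^bsub>S\<^esub>) n = f n"
    unfolding skew_poly_simps
    using assms by (subst finsum_eq_single[of n]) (auto simp: coeff_closed)
qed

lemma ring_skew_poly: "ring S"
proof (rule ringI)
  show "abelian_group S"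
  proof (rule abelian_groupI)
    fix f assume f: "f \<in> carrier S"
    show "\<exists>g\<in>carrier S. g \<oplus>\<^bsub>S\<^esub> f = \<zero>\<^bsub>S\<^esub>"
      using f up_a_inv_closed by (intro bexI[of _ "\<lambda>i. \<ominus> f i"]) (auto simp: l_neg coeff_closed)
  next
    show "\<zero>\<^bsub>S\<^esub> \<in> carrier S" by auto
  qed (auto simp: up_add_closed coeff_closed a_ac)
  show "Group.monoid S"
  proof (rule monoidI)
    fix f assume "f \<in> carrier S"
    then show "\<one>\<^bsub>S\<^esub> \<otimes>\<^bsub>S\<^esub> f = f"
      using const_mult[of \<one> f] by (simp add: const_def coeff_closed)
  qed (use skew_mult_assoc mult_one_S in \<open>auto simp: skew_mult_closed up_one_closed\<close>)
  fix f g h assume c: "f \<in> carrier S" "g \<in> carrier S" "h \<in> carrier S"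
  then have c': "f n \<in> carrier R" "g n \<in> carrier R" "h n \<in> carrier R" for n by auto
  show "(f \<oplus>\<^bsub>S\<^esub> g) \<otimes>\<^bsub>S\<^esub> h = f \<otimes>\<^bsub>S\<^esub> h \<oplus>\<^bsub>S\<^esub> g \<otimes>\<^bsub>S\<^esub> h"
    using c' by (simp add: l_distr finsum_addf Pi_def)
  show "h \<otimes>\<^bsub>S\<^esub> (f \<oplus>\<^bsub>S\<^esub> g) = h \<otimes>\<^bsub>S\<^esub> f \<oplus>\<^bsub>S\<^esub> h \<otimes>\<^bsub>S\<^esub> g"
    using c' by (simp add: r_distr finsum_addf Pi_def)
qed

sublocale S: ring S by (rule ring_skew_poly)

end


section \<open>Compatibility and nilpotent elements\<close>

locale compatible_endomorphism = ring_endomorphism +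
  assumes compat: "compatible R \<alpha>"
begin

lemma mult_funpow_eq_zero_iff:
  assumes "a \<in> carrier R" "b \<in> carrier R"
  shows "a \<otimes> (\<alpha> ^^ i) b = \<zero> \<longleftrightarrow> a \<otimes> b = \<zero>"
proof (induction i)
  case 0
  then show ?case by simp
next
  case (Suc i)
  have "a \<otimes> \<alpha> ((\<alpha> ^^ i) b) = \<zero> \<longleftrightarrow> a \<otimes> (\<alpha> ^^ i) b = \<zero>"
    using compat[unfolded compatible_def, rule_format, OF assms(1) funpow_closed[OF assms(2)]]
    by simp
  with Suc show ?case by simp
qed

text \<open>Compatibility acts on the rightmost factor only. To reach the middle one, apply
  \<open>\<alpha> ^^ i\<close> to \<open>c\<close> as well, merge the two images into that of
  \<open>b \<otimes> c\<close>, and remove it there.\<close>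

lemma mult_mult_funpow_eq_zero_iff:
  assumes "a \<in> carrier R" "b \<in> carrier R" "c \<in> carrier R"
  shows "a \<otimes> (\<alpha> ^^ i) b \<otimes> c = \<zero> \<longleftrightarrow> a \<otimes> b \<otimes> c = \<zero>"
proof -
  have "a \<otimes> (\<alpha> ^^ i) b \<otimes> c = \<zero> \<longleftrightarrow> a \<otimes> (\<alpha> ^^ i) b \<otimes> (\<alpha> ^^ i) c = \<zero>"
    using assms by (subst mult_funpow_eq_zero_iff) (auto simp: funpow_closed)
  also have "a \<otimes> (\<alpha> ^^ i) b \<otimes> (\<alpha> ^^ i) c = a \<otimes> (\<alpha> ^^ i) (b \<otimes> c)"
    using assms by (simp add: m_assoc)
  also have "\<dots> = \<zero> \<longleftrightarrow> a \<otimes> b \<otimes> c = \<zero>"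
    using assms by (subst mult_funpow_eq_zero_iff) (auto simp: m_assoc)
  finally show ?thesis .
qed

text \<open>The left factor \<open>c\<close> is there for the induction: it absorbs the leading
  factor of the power, so that the induction hypothesis strips \<open>\<alpha>\<close> from the
  remaining ones. The case of interest is \<open>c = \<one>\<close>.\<close>

lemma mult_pow_funpow_eq_zero_iff:
  assumes "a \<in> carrier R" "b \<in> carrier R" "c \<in> carrier R"
  shows "c \<otimes> (a \<otimes> (\<alpha> ^^ i) b) [^] (n::nat) = \<zero> \<longleftrightarrow> c \<otimes> (a \<otimes> b) [^] n = \<zero>"
  using assms(3)
proof (induction n arbitrary: c)
  case 0
  then show ?case by simp
next
  case (Suc n)
  let ?p = "(a \<otimes> b) [^] n" and ?q = "(a \<otimes> (\<alpha> ^^ i) b) [^] n"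
  have c: "?p \<in> carrier R" "?q \<in> carrier R" "(\<alpha> ^^ i) b \<in> carrier R"
    "c \<otimes> a \<in> carrier R" "c \<otimes> (a \<otimes> (\<alpha> ^^ i) b) \<in> carrier R"
    using assms Suc.prems by (auto simp: funpow_closed)
  have "c \<otimes> (a \<otimes> (\<alpha> ^^ i) b) [^] Suc n = c \<otimes> (a \<otimes> (\<alpha> ^^ i) b) \<otimes> ?q"
    using assms Suc.prems c by (subst nat_pow_Suc2) (auto simp: m_assoc)
  also have "\<dots> = \<zero> \<longleftrightarrow> c \<otimes> (a \<otimes> (\<alpha> ^^ i) b) \<otimes> ?p = \<zero>"
    using Suc.IH[OF c(5)] .
  also have "c \<otimes> (a \<otimes> (\<alpha> ^^ i) b) \<otimes> ?p = (c \<otimes> a) \<otimes> (\<alpha> ^^ i) b \<otimes> ?p"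
    using assms Suc.prems c by (simp add: m_assoc del: nat_pow_closed)
  also have "\<dots> = \<zero> \<longleftrightarrow> (c \<otimes> a) \<otimes> b \<otimes> ?p = \<zero>"
    by (rule mult_mult_funpow_eq_zero_iff[OF c(4) assms(2) c(1)])
  also have "(c \<otimes> a) \<otimes> b \<otimes> ?p = c \<otimes> (a \<otimes> b) [^] Suc n"
    using assms Suc.prems c by (subst nat_pow_Suc2) (auto simp: m_assoc simp del: nat_pow_closed)
  finally show ?case .
qed

text \<open>Once \<open>nilpotents R\<close> is an ideal, this is compatibility of the quotient.
  Both products even vanish at the same exponents.\<close>

lemma nilpotents_mult_funpow_iff:
  assumes "a \<in> carrier R" "b \<in> carrier R"
  shows "a \<otimes> (\<alpha> ^^ i) b \<in> nilpotents R \<longleftrightarrow> a \<otimes> b \<in> nilpotents R"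
proof -
  have "(a \<otimes> (\<alpha> ^^ i) b) [^] n = \<zero> \<longleftrightarrow> (a \<otimes> b) [^] n = \<zero>" for n :: nat
    using mult_pow_funpow_eq_zero_iff[OF assms one_closed, of i n] assms
    by (simp add: funpow_closed)
  then show ?thesis using assms by (auto simp: nilpotents_def funpow_closed)
qed

text \<open>Coefficients of the powers of \<open>f\<close> are annihilated by ever shorter products of
  coefficients of \<open>f\<close>, since compatibility lets one drop all powers of \<open>\<alpha>\<close>.\<close>
lemma nilpotents_skew_polyI:
  assumes f: "f \<in> up R" and L: "locally_nilpotent R L" "range f \<subseteq> L"
  shows "f \<in> nilpotents S"
proof -
  have fc: "f i \<in> carrier R" for i using f by (rule coeff_closed)
  then have Fc: "range f \<subseteq> carrier R" by auto
  obtain n where n: "bound \<zero> n f" using f by auto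
  have "range f \<subseteq> insert \<zero> (f ` {..n})"
  proof
    fix y assume "y \<in> range f"
    then obtain i where "y = f i" by auto
    then show "y \<in> insert \<zero> (f ` {..n})" using bound.bound[OF n, of i] by (cases "i \<le> n") auto
  qed
  then have "finite (range f)" by (rule finite_subset) simp
  then obtain K where K: "\<And>w. set w \<subseteq> range f \<Longrightarrow> length w = K \<Longrightarrow> foldr (\<otimes>) w \<one> = \<zero>"
    using L unfolding locally_nilpotent_def by meson
  \<comment> \<open>The left annihilator of all words of length \<open>k\<close> in the
    coefficients. \<open>Z K\<close> is all of \<open>R\<close> and \<open>Z 0\<close> is zero, and
    multiplying by \<open>f\<close> lowers the index by one.\<close>
  define Z where
    "Z k = {c \<in> carrier R. \<forall>w. set w \<subseteq> range f \<and> length w = k \<longrightarrow> c \<otimes> foldr (\<otimes>) w \<one> = \<zero>}" for k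
  have step: "(p \<otimes>\<^bsub>S\<^esub> f) m \<in> Z k" if p: "p \<in> up R" "\<And>i. p i \<in> Z (Suc k)" for p k m
  proof -
    have pc: "p i \<in> carrier R" for i using p(1) by (rule coeff_closed)
    have "(\<Oplus>i\<in>{..m}. p i \<otimes> (\<alpha> ^^ i) (f (m - i))) \<otimes> foldr (\<otimes>) w \<one> = \<zero>"
      if w: "set w \<subseteq> range f" "length w = k" for w
    proof -
      have wc: "foldr (\<otimes>) w \<one> \<in> carrier R" using w Fc by (intro foldr_mult_closed) auto
      have "p i \<otimes> (\<alpha> ^^ i) (f (m - i)) \<otimes> foldr (\<otimes>) w \<one> = \<zero>" for i
      proof -
        have "p i \<otimes> foldr (\<otimes>) (f (m - i) # w) \<one> = \<zero>"
          using p(2)[of i] w unfolding Z_def mem_Collect_eq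
          by (elim conjE allE[of _ "f (m - i) # w"] impE) auto
        then have "p i \<otimes> f (m - i) \<otimes> foldr (\<otimes>) w \<one> = \<zero>"
          using pc fc wc by (simp add: m_assoc)
        then show ?thesis using pc fc wc by (subst mult_mult_funpow_eq_zero_iff) auto
      qed
      moreover have "(\<Oplus>i\<in>{..m}. p i \<otimes> (\<alpha> ^^ i) (f (m - i))) \<otimes> foldr (\<otimes>) w \<one>
        = (\<Oplus>i\<in>{..m}. p i \<otimes> (\<alpha> ^^ i) (f (m - i)) \<otimes> foldr (\<otimes>) w \<one>)"
        using pc fc wc by (intro finsum_ldistr) (auto simp: funpow_closed)
      ultimately show ?thesis by (simp add: finsum_zero)
    qed
    moreover have "(\<Oplus>i\<in>{..m}. p i \<otimes> (\<alpha> ^^ i) (f (m - i))) \<in> carrier R"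
      using pc fc by (intro finsum_closed) (auto simp: funpow_closed)
    ultimately show ?thesis unfolding Z_def by simp
  qed
  have fS: "f \<in> carrier S" using f by simp
  have "\<forall>i. (f [^]\<^bsub>S\<^esub> j) i \<in> Z (K - j)" if "j \<le> K" for j
    using that
  proof (induction j)
    case 0
    then show ?case using K by (auto simp: Z_def)
  next
    case (Suc j)
    then have "\<And>i. (f [^]\<^bsub>S\<^esub> j) i \<in> Z (Suc (K - Suc j))"
      by (simp add: Suc_diff_Suc)
    moreover have "f [^]\<^bsub>S\<^esub> j \<in> up R" using S.nat_pow_closed[OF fS, of j] by simp
    ultimately show ?case unfolding S.nat_pow_Suc using step by blast
  qed
  from this[of K] have "(f [^]\<^bsub>S\<^esub> K) i \<in> Z 0" for i by simp
  then have "(f [^]\<^bsub>S\<^esub> K) i \<in> carrier R \<and> (f [^]\<^bsub>S\<^esub> K) i \<otimes> \<one> = \<zero>" for i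
    unfolding Z_def by simp
  then have "(f [^]\<^bsub>S\<^esub> K) i = \<zero>" for i using r_one by metis
  then have "f [^]\<^bsub>S\<^esub> K = \<zero>\<^bsub>S\<^esub>" by auto
  \<comment> \<open>\<open>nilpotents\<close> asks for a positive exponent, whereas \<open>K\<close>
    may be 0 when \<open>R\<close> is trivial.\<close>
  then have "f [^]\<^bsub>S\<^esub> Suc K = \<zero>\<^bsub>S\<^esub>"
    unfolding S.nat_pow_Suc using S.l_null[OF fS] by (simp only:)
  then show ?thesis using fS unfolding nilpotents_def by blast
qed

end

section \<open>Arithmetic modulo the ideal of nilpotent elements\<close>

locale weakly_2_primal_compatible = compatible_endomorphism +
  assumes w2p: "weakly_2_primal R"
begin

lemma locally_nilpotent_nilpotents: "locally_nilpotent R (nilpotents R)"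
  using locally_nilpotent_levitzki_radical w2p by (simp add: weakly_2_primal_def)

sublocale N: ideal "nilpotents R" R
  using ideal_levitzki_radical w2p by (simp add: weakly_2_primal_def)

text \<open>The form in which reducedness of the quotient by \<open>nilpotents R\<close> is
  used.\<close>

lemma nilpotents_square:
  assumes "a \<in> carrier R" "a \<otimes> a \<in> nilpotents R"
  shows "a \<in> nilpotents R"
proof -
  obtain n :: nat where n: "n > 0" "(a \<otimes> a) [^] n = \<zero>"
    using assms(2) unfolding nilpotents_def by blast
  have "a \<otimes> a = a [^] (2::nat)" using assms(1) by (simp add: numeral_2_eq_2)
  then have "a [^] (2 * n) = \<zero>" using n(2) assms(1) by (simp add: nat_pow_pow)
  then show ?thesis using n(1) assms(1) unfolding nilpotents_def by (auto intro!: exI[of _ "2 * n"])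
qed

text \<open>Reduced rings are reversible: the square of \<open>b \<otimes> a\<close> contains
  \<open>a \<otimes> b\<close> as a factor.\<close>

lemma nilpotents_swap:
  assumes "a \<in> carrier R" "b \<in> carrier R" "a \<otimes> b \<in> nilpotents R"
  shows "b \<otimes> a \<in> nilpotents R"
proof (rule nilpotents_square)
  have "(b \<otimes> a) \<otimes> (b \<otimes> a) = b \<otimes> (a \<otimes> b) \<otimes> a" using assms by (simp add: m_assoc)
  then show "(b \<otimes> a) \<otimes> (b \<otimes> a) \<in> nilpotents R"
    using assms N.I_l_closed N.I_r_closed by simp
qed (use assms in simp)

lemma finsum_nilpotents:
  assumes "finite A" "\<And>i. i \<in> A \<Longrightarrow> h i \<in> nilpotents R"
  shows "(\<Oplus>i\<in>A. h i) \<in> nilpotents R"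
  using assms
proof (induction A rule: finite_induct)
  case empty
  then show ?case by (simp add: N.zero_closed)
next
  case (insert i A)
  then show ?case using N.Icarr by (subst finsum_insert) (auto intro!: N.a_closed)
qed

text \<open>Descending induction on \<open>s = i + j\<close>, then on \<open>i\<close>: after multiplying the coefficient of
  \<open>x\<^sup>s\<close> in \<open>fg\<close> by \<open>f\<^sub>i\<close> on the right, every term but \<open>f\<^sub>i \<alpha>\<^sup>i(g\<^sub>j) f\<^sub>i\<close> is nilpotent.\<close>
lemma coeff_mult_nilpotent:
  assumes f: "f \<in> up R" and g: "g \<in> up R"
    and fg: "\<And>s. s > 0 \<Longrightarrow> (f \<otimes>\<^bsub>S\<^esub> g) s = \<zero>"
  shows "s > 0 \<Longrightarrow> i \<le> s \<Longrightarrow> f i \<otimes> g (s - i) \<in> nilpotents R"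
proof -
  have c: "f k \<in> carrier R" "g k \<in> carrier R" for k using f g by (auto simp: coeff_closed)
  obtain n m where b: "bound \<zero> n f" "bound \<zero> m g" using f g bound_upD by metis
  \<comment> \<open>The measure turns descent on \<open>s\<close> into well-founded induction. The
    summand 1 keeps it strictly decreasing at \<open>s = n + m\<close>; beyond that the degree
    bounds make one of the two factors zero.\<close>
  show "s > 0 \<Longrightarrow> i \<le> s \<Longrightarrow> f i \<otimes> g (s - i) \<in> nilpotents R"
  proof (induction s arbitrary: i rule: measure_induct_rule[of "\<lambda>s. n + m + 1 - s"])
    case (less s)
    note s = less.prems(1)
    show ?case
    proof (cases "n + m < s")
      case True
      have "f i = \<zero> \<or> g (s - i) = \<zero>"
      proof (cases "n < i")
        case True
        then show ?thesis using bound.bound[OF b(1)] by blast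
      next
        case False
        with True have "m < s - i" by arith
        then show ?thesis using bound.bound[OF b(2)] by blast
      qed
      then show ?thesis using c N.zero_closed by auto
    next
      case False
      have IH: "f k \<otimes> g (t - k) \<in> nilpotents R" if "s < t" "k \<le> t" for t k
        using that False less.prems(1) by (intro less.IH) auto
      \<comment> \<open>The inner induction also descends: its hypothesis covers the indices
        \<open>k\<close> with \<open>i < k \<le> s\<close>.\<close>
      show ?thesis
        using less.prems(2)
      proof (induction i rule: measure_induct_rule[of "\<lambda>i. s - i"])
        case (less i)
        let ?t = "\<lambda>k. f k \<otimes> (\<alpha> ^^ k) (g (s - k))"
        have tc: "?t k \<in> carrier R" for k using c by (simp add: funpow_closed)
        have other: "?t k \<otimes> f i \<in> nilpotents R" if "k \<le> s" "k \<noteq> i" for k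
        proof (cases "k < i")
          case True
          \<comment> \<open>For \<open>k < i\<close>, the indices of \<open>f i\<close> and
            \<open>g (s - k)\<close> add up to more than \<open>s\<close>, so the outer hypothesis
            applies. Inserting \<open>\<alpha> ^^ k\<close> and swapping then brings
            \<open>f i\<close> to the right, where it is needed.\<close>
          have "f i \<otimes> g (i + s - k - i) \<in> nilpotents R"
            using True less.prems by (intro IH) auto
          then have "f i \<otimes> g (s - k) \<in> nilpotents R" using True less.prems by simp
          then have "f i \<otimes> (\<alpha> ^^ k) (g (s - k)) \<in> nilpotents R"
            using c by (simp add: nilpotents_mult_funpow_iff)
          then have "(\<alpha> ^^ k) (g (s - k)) \<otimes> f i \<in> nilpotents R"
            by (rule nilpotents_swap[rotated 2]) (intro funpow_closed c)+
          then have "f k \<otimes> ((\<alpha> ^^ k) (g (s - k)) \<otimes> f i) \<in> nilpotents R"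
            using c N.I_l_closed by blast
          then show ?thesis using c by (simp add: m_assoc funpow_closed)
        next
          case False
          then have "f k \<otimes> g (s - k) \<in> nilpotents R"
            using that by (intro less.IH) auto
          then have "?t k \<in> nilpotents R"
            using c by (simp add: nilpotents_mult_funpow_iff)
          then show ?thesis using c N.I_r_closed by blast
        qed
        have "(\<Oplus>k\<in>{..s}. ?t k \<otimes> f i) = (\<Oplus>k\<in>{..s}. ?t k) \<otimes> f i"
          using c tc by (intro finsum_ldistr[symmetric]) auto
        also have "\<dots> = \<zero>" using fg[OF s] c by simp
        finally have "(\<Oplus>k\<in>insert i ({..s} - {i}). ?t k \<otimes> f i) = \<zero>"
          using less.prems by (simp add: insert_absorb)
        then have "?t i \<otimes> f i \<oplus> (\<Oplus>k\<in>{..s} - {i}. ?t k \<otimes> f i) = \<zero>"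
          using c tc by (subst (asm) finsum_insert) auto
        then have "?t i \<otimes> f i = \<ominus> (\<Oplus>k\<in>{..s} - {i}. ?t k \<otimes> f i)"
          using c tc by (intro minus_equality[symmetric]) (auto intro!: finsum_closed)
        also have "\<dots> \<in> nilpotents R"
          using other by (intro N.a_inv_closed finsum_nilpotents) auto
        finally have "?t i \<otimes> f i \<in> nilpotents R" .
        \<comment> \<open>The extra right factor completes the square of \<open>?t i\<close>, which
          makes reducedness applicable.\<close>
        then have "?t i \<otimes> f i \<otimes> (\<alpha> ^^ i) (g (s - i)) \<in> nilpotents R"
          by (rule N.I_r_closed) (intro funpow_closed c)
        then have "?t i \<otimes> ?t i \<in> nilpotents R" using c by (simp add: m_assoc funpow_closed)
        then have "?t i \<in> nilpotents R" using tc by (rule nilpotents_square[rotated])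
        then show ?case using c by (simp add: nilpotents_mult_funpow_iff)
      qed
    qed
  qed
qed

section \<open>Units and Delta of the skew polynomial ring\<close>

lemma Units_skew_poly_iff:
  assumes f: "f \<in> up R"
  shows "f \<in> Units S \<longleftrightarrow> f 0 \<in> Units R \<and> (\<forall>i>0. f i \<in> nilpotents R)"
proof (intro iffI conjI allI impI)
  have fc: "f k \<in> carrier R" for k using f by (rule coeff_closed)
  {
    assume "f \<in> Units S"
    then obtain g where g: "g \<in> up R" "g \<otimes>\<^bsub>S\<^esub> f = \<one>\<^bsub>S\<^esub>" "f \<otimes>\<^bsub>S\<^esub> g = \<one>\<^bsub>S\<^esub>"
      unfolding Units_def by auto
    have gc: "g k \<in> carrier R" for k using g(1) by (rule coeff_closed)
    have "(g \<otimes>\<^bsub>S\<^esub> f) 0 = \<one>" "(f \<otimes>\<^bsub>S\<^esub> g) 0 = \<one>" unfolding g(2,3) by simp_all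
    then have inv: "g 0 \<otimes> f 0 = \<one>" "f 0 \<otimes> g 0 = \<one>" using fc gc by simp_all
    then show "f 0 \<in> Units R" using fc gc unfolding Units_def by blast
    fix i :: nat assume "i > 0"
    moreover have "(f \<otimes>\<^bsub>S\<^esub> g) s = \<zero>" if "s > 0" for s unfolding g(3) using that by simp
    \<comment> \<open>Taking total degree \<open>i\<close> pairs \<open>f i\<close> with
      \<open>g 0\<close>, which is invertible and so can be cancelled modulo the ideal.\<close>
    ultimately have "f i \<otimes> g (i - i) \<in> nilpotents R"
      using f g(1) by (intro coeff_mult_nilpotent) auto
    then have "f i \<otimes> g 0 \<otimes> f 0 \<in> nilpotents R" using fc N.I_r_closed by simp
    then show "f i \<in> nilpotents R" using fc gc inv by (simp add: m_assoc)
  }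
  assume "f 0 \<in> Units R \<and> (\<forall>i>0. f i \<in> nilpotents R)"
  then have u: "f 0 \<in> Units R" and nil: "\<And>i. i > 0 \<Longrightarrow> f i \<in> nilpotents R" by auto
  define v where "v = inv (f 0)"
  have v: "v \<in> carrier R" "v \<otimes> f 0 = \<one>" "f 0 \<otimes> v = \<one>" using u by (auto simp: v_def)
  \<comment> \<open>Chosen so that \<open>f\<close> equals \<open>const (f 0)\<close> times
    \<open>1 + h\<close>, with all coefficients of \<open>h\<close> nilpotent; the second factor is
    a unit because \<open>h\<close> itself is nilpotent.\<close>
  define h where "h = (\<lambda>i. if i = 0 then \<zero> else v \<otimes> f i)"
  have hc: "h \<in> up R"
  proof
    obtain n where "bound \<zero> n f" using f by auto
    then have "bound \<zero> n h" using v(1) by (auto simp: h_def bound_def)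
    then show "\<exists>n. bound \<zero> n h" by blast
    show "h i \<in> carrier R" for i using v(1) fc by (simp add: h_def)
  qed
  have "range h \<subseteq> nilpotents R"
    using nil v(1) N.zero_closed N.I_l_closed by (auto simp: h_def)
  then have "h \<in> nilpotents S"
    using hc locally_nilpotent_nilpotents by (intro nilpotents_skew_polyI)
  then have 1: "\<one>\<^bsub>S\<^esub> \<oplus>\<^bsub>S\<^esub> h \<in> Units S" by (rule S.Units_one_plus_nilpotent)
  have inv: "const a \<otimes>\<^bsub>S\<^esub> const b = \<one>\<^bsub>S\<^esub>"
    if "a \<in> carrier R" "b \<in> carrier R" "a \<otimes> b = \<one>" for a b
  proof -
    have "const a \<otimes>\<^bsub>S\<^esub> const b = (\<lambda>n. a \<otimes> const b n)"
      using that const_closed by (intro const_mult)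
    then show ?thesis using that by (auto simp: const_def)
  qed
  have 2: "const (f 0) \<in> Units S"
    unfolding Units_def using inv[OF v(1) fc v(2)] inv[OF fc v(1) v(3)] const_closed[OF v(1)] const_closed[OF fc]
    by (auto simp del: skew_poly_simps(2,3))
  have "const (f 0) \<otimes>\<^bsub>S\<^esub> (\<one>\<^bsub>S\<^esub> \<oplus>\<^bsub>S\<^esub> h) = (\<lambda>i. f 0 \<otimes> (\<one>\<^bsub>S\<^esub> \<oplus>\<^bsub>S\<^esub> h) i)"
    using fc S.Units_closed[OF 1] by (intro const_mult) auto
  also have "\<dots> = f"
  proof
    show "f 0 \<otimes> (\<one>\<^bsub>S\<^esub> \<oplus>\<^bsub>S\<^esub> h) i = f i" for i
      using fc v by (simp add: h_def m_assoc[symmetric])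
  qed
  finally show "f \<in> Units S" using S.Units_m_closed[OF 2 1] by simp
qed

text \<open>Constant units suffice as test elements: adding one changes only the constant term, so
  \<open>\<one>\<close> already reveals the higher coefficients. Conversely, adding any unit keeps
  the higher coefficients in the ideal of nilpotents.\<close>

lemma Delta_skew_poly_iff:
  assumes f: "f \<in> up R"
  shows "f \<in> Delta S \<longleftrightarrow> f 0 \<in> Delta R \<and> (\<forall>i>0. f i \<in> nilpotents R)"
proof (intro iffI conjI allI impI)
  have fc: "f k \<in> carrier R" for k using f by (rule coeff_closed)
  have const: "const u \<in> Units S" if "u \<in> Units R" for u
    using that unfolding Units_skew_poly_iff[OF const_closed[OF Units_closed[OF that]]]
    by (simp add: const_def N.zero_closed)
  {
    assume D: "f \<in> Delta S"
    have "f \<oplus>\<^bsub>S\<^esub> const u \<in> Units S" if "u \<in> Units R" for u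
      using D const[OF that] unfolding Delta_def by blast
    then have *: "(f \<oplus>\<^bsub>S\<^esub> const u) 0 \<in> Units R \<and> (\<forall>i>0. (f \<oplus>\<^bsub>S\<^esub> const u) i \<in> nilpotents R)"
      if "u \<in> Units R" for u
      using that Units_skew_poly_iff[of "f \<oplus>\<^bsub>S\<^esub> const u"] up_add_closed[OF f const_closed[OF Units_closed[OF that]]]
      by simp
    show "f 0 \<in> Delta R" using * fc by (simp add: Delta_def const_def)
    show "f i \<in> nilpotents R" if "i > 0" for i
      using *[OF Units_one_closed] that fc by (simp add: const_def)
  }
  assume D: "f 0 \<in> Delta R \<and> (\<forall>i>0. f i \<in> nilpotents R)"
  have "f \<oplus>\<^bsub>S\<^esub> u \<in> Units S" if u: "u \<in> Units S" for u
  proof -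
    have uc: "u \<in> up R" using S.Units_closed[OF u] by simp
    have "u 0 \<in> Units R \<and> (\<forall>i>0. u i \<in> nilpotents R)"
      using u Units_skew_poly_iff[OF uc] by blast
    then have "(f \<oplus>\<^bsub>S\<^esub> u) 0 \<in> Units R \<and> (\<forall>i>0. (f \<oplus>\<^bsub>S\<^esub> u) i \<in> nilpotents R)"
      using D by (auto simp: Delta_def intro: N.a_closed)
    moreover have "f \<oplus>\<^bsub>S\<^esub> u \<in> up R" using up_add_closed[OF f uc] by simp
    ultimately show ?thesis using Units_skew_poly_iff by blast
  qed
  then show "f \<in> Delta S" using f unfolding Delta_def by simp
qed

end

section \<open>Transfer of the WDeltaU condition\<close>

text \<open>Since \<open>\<one>\<close> and \<open>\<ominus> \<one>\<close> are units, adding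
  elements of \<open>Delta R\<close> to them always gives units. Only the other inclusion has
  content, and it is a condition on each unit separately.\<close>

lemma (in ring) WDeltaU_iff:
  "WDeltaU R \<longleftrightarrow> (\<forall>u\<in>Units R. u \<ominus> \<one> \<in> Delta R \<or> u \<oplus> \<one> \<in> Delta R)"
proof -
  have D: "d \<in> carrier R" "d \<oplus> u \<in> Units R" if "d \<in> Delta R" "u \<in> Units R" for d u
    using that by (auto simp: Delta_def)
  have "\<ominus> \<one> \<otimes> \<ominus> \<one> = \<one>" by (simp add: l_minus r_minus)
  then have m: "\<ominus> \<one> \<in> Units R" unfolding Units_def by auto
  have plus: "u \<in> {\<one> \<oplus> d | d. d \<in> Delta R} \<longleftrightarrow> u \<ominus> \<one> \<in> Delta R" if "u \<in> carrier R" for u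
  proof
    assume "u \<in> {\<one> \<oplus> d | d. d \<in> Delta R}"
    then obtain d where d: "u = \<one> \<oplus> d" "d \<in> Delta R" by auto
    have "u \<ominus> \<one> = d \<oplus> (\<one> \<oplus> \<ominus> \<one>)" using d D(1)[OF d(2) m] by (simp add: a_minus_def a_ac)
    then show "u \<ominus> \<one> \<in> Delta R" using d D(1)[OF d(2) m] by (simp add: r_neg)
  next
    assume d: "u \<ominus> \<one> \<in> Delta R"
    have "\<one> \<oplus> (u \<ominus> \<one>) = u \<oplus> (\<one> \<oplus> \<ominus> \<one>)" using that by (simp add: a_minus_def a_ac)
    then have "u = \<one> \<oplus> (u \<ominus> \<one>)" using that by (simp add: r_neg)
    then show "u \<in> {\<one> \<oplus> d | d. d \<in> Delta R}" using d by blast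
  qed
  have minus: "u \<in> {\<ominus> \<one> \<oplus> d | d. d \<in> Delta R} \<longleftrightarrow> u \<oplus> \<one> \<in> Delta R" if "u \<in> carrier R" for u
  proof
    assume "u \<in> {\<ominus> \<one> \<oplus> d | d. d \<in> Delta R}"
    then obtain d where d: "u = \<ominus> \<one> \<oplus> d" "d \<in> Delta R" by auto
    have "u \<oplus> \<one> = d \<oplus> (\<one> \<oplus> \<ominus> \<one>)" using d D(1)[OF d(2) m] by (simp add: a_ac)
    then show "u \<oplus> \<one> \<in> Delta R" using d D(1)[OF d(2) m] by (simp add: r_neg)
  next
    assume d: "u \<oplus> \<one> \<in> Delta R"
    have "\<ominus> \<one> \<oplus> (u \<oplus> \<one>) = u \<oplus> (\<one> \<oplus> \<ominus> \<one>)" using that by (simp add: a_ac)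
    then have "u = \<ominus> \<one> \<oplus> (u \<oplus> \<one>)" using that by (simp add: r_neg)
    then show "u \<in> {\<ominus> \<one> \<oplus> d | d. d \<in> Delta R}" using d by blast
  qed
  have sub: "{\<one> \<oplus> d | d. d \<in> Delta R} \<union> {\<ominus> \<one> \<oplus> d | d. d \<in> Delta R} \<subseteq> Units R"
  proof -
    have "\<one> \<oplus> d \<in> Units R" "\<ominus> \<one> \<oplus> d \<in> Units R" if "d \<in> Delta R" for d
      using D(2)[OF that Units_one_closed] D(2)[OF that m] D(1)[OF that m] by (simp_all add: a_comm)
    then show ?thesis by blast
  qed
  show ?thesis
    unfolding WDeltaU_def
  proof
    assume eq: "Units R = {\<one> \<oplus> d | d. d \<in> Delta R} \<union> {\<ominus> \<one> \<oplus> d | d. d \<in> Delta R}"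
    show "\<forall>u\<in>Units R. u \<ominus> \<one> \<in> Delta R \<or> u \<oplus> \<one> \<in> Delta R"
    proof
      fix u assume u: "u \<in> Units R"
      then have "u \<in> {\<one> \<oplus> d | d. d \<in> Delta R} \<or> u \<in> {\<ominus> \<one> \<oplus> d | d. d \<in> Delta R}"
        unfolding eq by (rule UnE) auto
      then show "u \<ominus> \<one> \<in> Delta R \<or> u \<oplus> \<one> \<in> Delta R"
        unfolding plus[OF Units_closed[OF u]] minus[OF Units_closed[OF u]] .
    qed
  next
    assume all: "\<forall>u\<in>Units R. u \<ominus> \<one> \<in> Delta R \<or> u \<oplus> \<one> \<in> Delta R"
    show "Units R = {\<one> \<oplus> d | d. d \<in> Delta R} \<union> {\<ominus> \<one> \<oplus> d | d. d \<in> Delta R}"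
    proof (intro equalityI sub subsetI)
      fix u assume u: "u \<in> Units R"
      then have "u \<ominus> \<one> \<in> Delta R \<or> u \<oplus> \<one> \<in> Delta R" using all by blast
      then have "u \<in> {\<one> \<oplus> d | d. d \<in> Delta R} \<or> u \<in> {\<ominus> \<one> \<oplus> d | d. d \<in> Delta R}"
        unfolding plus[OF Units_closed[OF u]] minus[OF Units_closed[OF u]] .
      then show "u \<in> {\<one> \<oplus> d | d. d \<in> Delta R} \<union> {\<ominus> \<one> \<oplus> d | d. d \<in> Delta R}"
        by (rule Un_iff[THEN iffD2])
    qed
  qed
qed

context weakly_2_primal_compatible
begin

text \<open>Negation in \<open>S\<close> is given by a description operator, so its coefficients
  have to be identified through uniqueness of the inverse.\<close>

lemma minus_one_skew_poly: "\<ominus>\<^bsub>S\<^esub> \<one>\<^bsub>S\<^esub> = const (\<ominus> \<one>)"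
proof (rule S.minus_equality)
  show "const (\<ominus> \<one>) \<oplus>\<^bsub>S\<^esub> \<one>\<^bsub>S\<^esub> = \<zero>\<^bsub>S\<^esub>" by (auto simp: const_def l_neg)
  show "const (\<ominus> \<one>) \<in> carrier S" using const_closed by simp
qed (rule S.one_closed)

text \<open>The instances \<open>e = \<one>\<close> and \<open>e = \<ominus> \<one>\<close> treat
  both signs of the WDeltaU condition.\<close>

lemma Delta_coeff_shift_iff:
  assumes f: "f \<in> up R" and e: "e \<in> carrier R"
  shows "f \<oplus>\<^bsub>S\<^esub> const e \<in> Delta S \<longleftrightarrow> f 0 \<oplus> e \<in> Delta R \<and> (\<forall>i>0. f i \<in> nilpotents R)"
proof -
  have "f \<oplus>\<^bsub>S\<^esub> const e \<in> up R" using up_add_closed[OF f const_closed[OF e]] by simp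
  from Delta_skew_poly_iff[OF this] show ?thesis
    using coeff_closed[OF f] by (simp add: const_def)
qed

lemma WDeltaU_skew_poly_iff: "WDeltaU S \<longleftrightarrow> WDeltaU R"
proof -
  \<comment> \<open>The requirement on the higher coefficients is the same for both signs, and every
    unit of \<open>S\<close> meets it. For units, only the constant term is left to compare.\<close>
  have shift: "(f \<ominus>\<^bsub>S\<^esub> \<one>\<^bsub>S\<^esub> \<in> Delta S \<or> f \<oplus>\<^bsub>S\<^esub> \<one>\<^bsub>S\<^esub> \<in> Delta S) \<longleftrightarrow>
    (f 0 \<ominus> \<one> \<in> Delta R \<or> f 0 \<oplus> \<one> \<in> Delta R) \<and> (\<forall>i>0. f i \<in> nilpotents R)"
    if f: "f \<in> up R" for f
  proof -
    have "\<one>\<^bsub>S\<^esub> = const \<one>" by (simp add: const_def)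
    then have "f \<oplus>\<^bsub>S\<^esub> \<one>\<^bsub>S\<^esub> \<in> Delta S \<longleftrightarrow> f 0 \<oplus> \<one> \<in> Delta R \<and> (\<forall>i>0. f i \<in> nilpotents R)"
      using Delta_coeff_shift_iff[OF f one_closed] by (simp only:)
    moreover have "f \<ominus>\<^bsub>S\<^esub> \<one>\<^bsub>S\<^esub> \<in> Delta S \<longleftrightarrow> f 0 \<ominus> \<one> \<in> Delta R \<and> (\<forall>i>0. f i \<in> nilpotents R)"
      unfolding a_minus_def[of S] a_minus_def[of R] minus_one_skew_poly
      using Delta_coeff_shift_iff[OF f a_inv_closed[OF one_closed]] .
    ultimately show ?thesis by blast
  qed
  show ?thesis
    unfolding WDeltaU_iff S.WDeltaU_iff
  proof (intro iffI ballI)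
    fix u assume S: "\<forall>f\<in>Units S. f \<ominus>\<^bsub>S\<^esub> \<one>\<^bsub>S\<^esub> \<in> Delta S \<or> f \<oplus>\<^bsub>S\<^esub> \<one>\<^bsub>S\<^esub> \<in> Delta S"
      and u: "u \<in> Units R"
    have c: "const u \<in> up R" using u by (intro const_closed) auto
    have "const u \<in> Units S"
      using u unfolding Units_skew_poly_iff[OF c] by (simp add: const_def N.zero_closed)
    then have "const u 0 \<ominus> \<one> \<in> Delta R \<or> const u 0 \<oplus> \<one> \<in> Delta R"
      using S shift[OF c] by blast
    then show "u \<ominus> \<one> \<in> Delta R \<or> u \<oplus> \<one> \<in> Delta R" by (simp add: const_def)
  next
    fix f assume R: "\<forall>u\<in>Units R. u \<ominus> \<one> \<in> Delta R \<or> u \<oplus> \<one> \<in> Delta R" and f: "f \<in> Units S"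
    have c: "f \<in> up R" using S.Units_closed[OF f] by simp
    show "f \<ominus>\<^bsub>S\<^esub> \<one>\<^bsub>S\<^esub> \<in> Delta S \<or> f \<oplus>\<^bsub>S\<^esub> \<one>\<^bsub>S\<^esub> \<in> Delta S"
      unfolding shift[OF c] using R f Units_skew_poly_iff[OF c] by blast
  qed
qed

end

theorem theorem4p5:
  fixes R :: "('a, 'm) ring_scheme" and \<alpha> :: "'a \<Rightarrow> 'a"
  assumes "ring R"
    and "weakly_2_primal R"
    and "\<alpha> \<in> ring_hom R R"
    and "compatible R \<alpha>"
  shows "WDeltaU (skew_poly R \<alpha>) \<longleftrightarrow> WDeltaU R"
proof -
  interpret weakly_2_primal_compatible R \<alpha>
    using assms
    by (intro weakly_2_primal_compatible.intro compatible_endomorphism.intro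
        ring_endomorphism.intro ring_endomorphism_axioms.intro
        compatible_endomorphism_axioms.intro weakly_2_primal_compatible_axioms.intro)
  show ?thesis by (rule WDeltaU_skew_poly_iff)
qed

end
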